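(* Let $P$ be a finite graded poset with unique minimum $\hat 0$ and unique maximum $\hat 1$, let $(A,\le^\circ)$ be a partially ordered set whose elements are atoms of $P$, and let $A'\subseteq A$ be linearly ordered by the order inherited from $A$. Suppose: (i) $P\langle A\rangle$ is $A$-shellable; and (ii) for every $b\in A\setminus A'$ and every $p\in P\langle A'\rangle$ with $p\gtrdot b$, there is $b'\in A'$ appearing before $b$ in $A$ (i.e., $b'<^\circ b$) with $p\gtrdot b'$. Then $P\langle A'\rangle$ is $A'$-shellable.
   Context: An atom of $P$ is an element covering $\hat 0$; $x\gtrdot y$ means $x$ covers $y$. For a set $B$ of atoms of $P$, $P\langle B\rangle$ is the induced subposet on $\{\hat 0\}\cup\{x\in P: x\ge a\text{ for some }a\in B\}$. A maximal-chain order of a bounded poset is a shelling order if whenever $c'$ precedes $c$ there is $c^*$ preceding $c$ with $c\cap c^*\supseteq c\cap c'$ and $|c\,\Delta\, c^*|=2$. For a partially ordered set $(B,\le^\circ)$ of atoms, $P\langle B\rangle$ is $B$-shellable if it has a shelling order in which a maximal chain $c'$ precedes a maximal chain $c$ whenever the atom of $c'$ is strictly $\le^\circ$-smaller than the atom of $c$. *)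

theory Defs
  imports Main
begin

text \<open>
  A finite poset is a carrier \<open>P\<close> with a relation \<open>r\<close> (\<open>(x, y) \<in> r\<close> meaning \<open>x \<le> y\<close>) such that
  \<open>partial_order_on P r\<close>. All notions below only look at \<open>r\<close> on the carrier they are given, so the
  induced subposet on \<open>Q \<subseteq> P\<close> is obtained by passing \<open>Q\<close> instead of \<open>P\<close>, with the same \<open>r\<close>.
  The strict part of an order \<open>r\<close> is \<open>r - Id\<close>.
\<close>

definition max_chains :: "'a set \<Rightarrow> 'a rel \<Rightarrow> 'a set set" where
  "max_chains P r = {c. pred_on.maxchain P (\<lambda>x y. (x, y) \<in> r) c}"

definition graded :: "'a set \<Rightarrow> 'a rel \<Rightarrow> bool" where
  "graded P r \<longleftrightarrow> (\<forall>c\<in>max_chains P r. \<forall>d\<in>max_chains P r. card c = card d)"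

definition covers :: "'a set \<Rightarrow> 'a rel \<Rightarrow> 'a \<Rightarrow> 'a \<Rightarrow> bool" where
  "covers P r x y \<longleftrightarrow> x \<in> P \<and> y \<in> P \<and> (y, x) \<in> r - Id \<and>
     \<not> (\<exists>w\<in>P. (y, w) \<in> r - Id \<and> (w, x) \<in> r - Id)"

text \<open>Here and below, \<open>z\<close> is the minimum of the poset.\<close>

definition atoms :: "'a set \<Rightarrow> 'a rel \<Rightarrow> 'a \<Rightarrow> 'a set" where
  "atoms P r z = {a. covers P r a z}"

definition generated :: "'a set \<Rightarrow> 'a rel \<Rightarrow> 'a \<Rightarrow> 'a set \<Rightarrow> 'a set" where
  "generated P r z B = {z} \<union> {x \<in> P. \<exists>a\<in>B. (a, x) \<in> r}"

definition shelling_order :: "'a set \<Rightarrow> 'a rel \<Rightarrow> 'a set rel \<Rightarrow> bool" where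
  "shelling_order Q r t \<longleftrightarrow> linear_order_on (max_chains Q r) t \<and>
     (\<forall>c\<in>max_chains Q r. \<forall>c'\<in>max_chains Q r. (c', c) \<in> t - Id \<longrightarrow>
        (\<exists>d\<in>max_chains Q r. (d, c) \<in> t - Id \<and> c \<inter> c' \<subseteq> c \<inter> d \<and> card (sym_diff c d) = 2))"

text \<open>
  The subposet of \<open>P\<close> generated by \<open>B\<close> is \<open>B\<close>-shellable, where \<open>s\<close> is the partial order on \<open>B\<close>.
  A maximal chain of a poset with minimum contains at most one atom, and none only if
  the poset is \<open>{z}\<close> (that is, \<open>B = {}\<close>); so quantifying over the atoms in \<open>c\<close> is the same as
  speaking of the atom of \<open>c\<close>.
\<close>

definition atom_shellable :: "'a set \<Rightarrow> 'a rel \<Rightarrow> 'a \<Rightarrow> 'a set \<Rightarrow> 'a rel \<Rightarrow> bool" where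
  "atom_shellable P r z B s \<longleftrightarrow> (let Q = generated P r z B in
     \<exists>t. shelling_order Q r t \<and>
       (\<forall>c\<in>max_chains Q r. \<forall>c'\<in>max_chains Q r.
          \<forall>a \<in> c \<inter> atoms Q r z. \<forall>a' \<in> c' \<inter> atoms Q r z.
            (a', a) \<in> s - Id \<longrightarrow> (c', c) \<in> t - Id))"

end

theory Submission
  imports Defs
begin

text \<open>
  If \<open>A'\<close> is nonempty, the maximal chains of \<open>P\<langle>A'\<rangle>\<close> are those maximal chains of
  \<open>P\<langle>A\<rangle>\<close> whose atom lies in \<open>A'\<close>, and the given shelling order of \<open>P\<langle>A\<rangle>\<close>, restricted to them,
  is again a shelling order. Let \<open>c'\<close> precede \<open>c\<close>, and let \<open>d\<close> be the chain preceding \<open>c\<close> that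
  the shelling of \<open>P\<langle>A\<rangle>\<close> provides. If the atom \<open>b\<close> of \<open>d\<close> is not in \<open>A'\<close>, then \<open>d\<close> arises from
  \<open>c\<close> by exchanging the atom \<open>a\<close> of \<open>c\<close> for \<open>b\<close>, so \<open>b\<close> is covered by the element \<open>p\<close> of \<open>c\<close>
  above \<open>a\<close>, and hypothesis (ii) yields \<open>b' < b\<close> in \<open>A'\<close> below \<open>p\<close>. Exchanging \<open>a\<close> for \<open>b'\<close> gives a
  chain of \<open>P\<langle>A'\<rangle>\<close> that precedes \<open>d\<close>, hence \<open>c\<close>, and has the same intersection with \<open>c\<close> as \<open>d\<close>.
\<close>

lemma linear_order_on_Restr_subset:
  assumes "linear_order_on X t" and "Y \<subseteq> X"
  shows "linear_order_on Y (Restr t Y)"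
proof -
  have "trans (Restr t Y)" "antisym (Restr t Y)"
    using assms(1) unfolding order_on_defs trans_def antisym_def by blast+
  moreover have "total_on Y (Restr t Y)" "refl_on Y (Restr t Y)"
    using assms unfolding order_on_defs refl_on_def total_on_def by (auto simp: subset_iff)
  ultimately show ?thesis unfolding order_on_defs by blast
qed

section \<open>Finite bounded posets and their maximal chains\<close>

locale finite_bounded_poset =
  fixes P :: "'a set" and r :: "'a rel" and z u :: 'a
  assumes finite_carrier: "finite P" and order: "partial_order_on P r"
    and bot_in: "z \<in> P" and bot_le: "\<And>x. x \<in> P \<Longrightarrow> (z, x) \<in> r"
    and top_in: "u \<in> P" and le_top: "\<And>x. x \<in> P \<Longrightarrow> (x, u) \<in> r"
begin

lemma le_refl: "x \<in> P \<Longrightarrow> (x, x) \<in> r"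
  using order unfolding partial_order_on_def preorder_on_def refl_on_def by blast

lemma le_trans: "(x, y) \<in> r \<Longrightarrow> (y, w) \<in> r \<Longrightarrow> (x, w) \<in> r"
  using order unfolding partial_order_on_def preorder_on_def trans_def by blast

lemma le_antisym: "(x, y) \<in> r \<Longrightarrow> (y, x) \<in> r \<Longrightarrow> x = y"
  using order unfolding partial_order_on_def antisym_def by blast

text \<open>An element comparable to the whole of a chain can be inserted into it, and any strictly
  larger chain supplies such an element, so maximality can be tested one element at a time.
  \<open>pred_on.chain\<close> compares by the reflexive closure, which \<open>r\<close> absorbs,
  being reflexive on \<open>P\<close>.\<close>

lemma max_chains_iff:
  assumes "Q \<subseteq> P"
  shows "c \<in> max_chains Q r \<longleftrightarrow> c \<subseteq> Q \<and> (\<forall>x\<in>c. \<forall>y\<in>c. (x, y) \<in> r \<or> (y, x) \<in> r) \<and>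
    (\<forall>x\<in>Q. (\<forall>y\<in>c. (x, y) \<in> r \<or> (y, x) \<in> r) \<longrightarrow> x \<in> c)"
    (is "?l \<longleftrightarrow> ?sub \<and> ?chain \<and> ?max")
proof -
  have ch: "pred_on.chain Q (\<lambda>x y. (x, y) \<in> r) C \<longleftrightarrow>
      C \<subseteq> Q \<and> (\<forall>x\<in>C. \<forall>y\<in>C. (x, y) \<in> r \<or> (y, x) \<in> r)" for C
    unfolding pred_on.chain_def using assms le_refl by (auto simp: subset_iff) metis+
  show ?thesis
  proof
    assume l: ?l
    then have c: ?sub ?chain
      unfolding max_chains_def pred_on.maxchain_def ch by auto
    have ?max
    proof (intro ballI impI)
      fix x assume x: "x \<in> Q" "\<forall>y\<in>c. (x, y) \<in> r \<or> (y, x) \<in> r"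
      with c have "pred_on.chain Q (\<lambda>x y. (x, y) \<in> r) (insert x c)"
        unfolding ch using assms le_refl by blast
      with l show "x \<in> c"
        unfolding max_chains_def pred_on.maxchain_def by blast
    qed
    with c show "?sub \<and> ?chain \<and> ?max" by blast
  next
    assume "?sub \<and> ?chain \<and> ?max"
    then show ?l
      unfolding max_chains_def pred_on.maxchain_def ch by blast
  qed
qed

lemma max_chain_subset:
  "Q \<subseteq> P \<Longrightarrow> c \<in> max_chains Q r \<Longrightarrow> c \<subseteq> Q"
  by (simp add: max_chains_iff)

lemma max_chain_comparable:
  "Q \<subseteq> P \<Longrightarrow> c \<in> max_chains Q r \<Longrightarrow> x \<in> c \<Longrightarrow> y \<in> c \<Longrightarrow> (x, y) \<in> r \<or> (y, x) \<in> r"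
  by (simp add: max_chains_iff)

lemma max_chain_maximal:
  "Q \<subseteq> P \<Longrightarrow> c \<in> max_chains Q r \<Longrightarrow> x \<in> Q \<Longrightarrow>
    (\<And>y. y \<in> c \<Longrightarrow> (x, y) \<in> r \<or> (y, x) \<in> r) \<Longrightarrow> x \<in> c"
  by (simp add: max_chains_iff)

lemma chain_has_least:
  assumes "S \<subseteq> P" and "S \<noteq> {}" and "\<And>x y. x \<in> S \<Longrightarrow> y \<in> S \<Longrightarrow> (x, y) \<in> r \<or> (y, x) \<in> r"
  obtains m where "m \<in> S" and "\<And>x. x \<in> S \<Longrightarrow> (m, x) \<in> r"
proof -
  have "finite S" using assms(1) finite_carrier finite_subset by blast
  then have "\<exists>m\<in>S. \<forall>x\<in>S. (m, x) \<in> r"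
    using assms(2,1,3)
  proof (induction rule: finite_ne_induct)
    case (singleton x)
    then show ?case using le_refl by blast
  next
    case (insert x F)
    then obtain m where m: "m \<in> F" "\<forall>y\<in>F. (m, y) \<in> r" by auto
    have "(x, m) \<in> r \<or> (m, x) \<in> r" and "(x, x) \<in> r"
      using insert.prems m(1) le_refl by auto
    with m show ?case using le_trans by blast
  qed
  with that show ?thesis by blast
qed

section \<open>Atoms and the subposets that they generate\<close>

lemma atomD:
  assumes "a \<in> atoms P r z"
  shows "a \<in> P" and "a \<noteq> z" and "(x, a) \<in> r \<Longrightarrow> x \<in> P \<Longrightarrow> x = z \<or> x = a"
  using assms bot_le unfolding atoms_def covers_def by auto

lemma generated_subset: "generated P r z B \<subseteq> P"
  using bot_in unfolding generated_def by auto

lemma generated_mono: "B \<subseteq> C \<Longrightarrow> generated P r z B \<subseteq> generated P r z C"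
  unfolding generated_def by auto

lemma generatedI: "a \<in> B \<Longrightarrow> x \<in> P \<Longrightarrow> (a, x) \<in> r \<Longrightarrow> x \<in> generated P r z B"
  unfolding generated_def by auto

lemma bot_in_generated: "z \<in> generated P r z B"
  unfolding generated_def by auto

text \<open>An atom of the subposet lies above some \<open>a\<close> in \<open>B\<close>; as
  \<open>a\<close> is itself in the subposet and above \<open>z\<close>, the two coincide. This
  turns the conditions of \<open>atom_shellable\<close> into conditions on \<open>B\<close>.\<close>

lemma atoms_generated:
  assumes "B \<subseteq> atoms P r z"
  shows "atoms (generated P r z B) r z = B"
proof
  show "atoms (generated P r z B) r z \<subseteq> B"
  proof
    fix x assume x: "x \<in> atoms (generated P r z B) r z"
    then obtain a where a: "a \<in> B" "(a, x) \<in> r"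
      unfolding atoms_def covers_def generated_def by auto
    then have "a \<in> P" "a \<noteq> z" using assms atomD by auto
    then have "a \<in> generated P r z B" "(z, a) \<in> r - Id"
      using a generatedI[of a B a] le_refl bot_le by auto
    with x a(2) have "a = x" unfolding atoms_def covers_def by blast
    with a(1) show "x \<in> B" by simp
  qed
  show "B \<subseteq> atoms (generated P r z B) r z"
  proof
    fix x assume x: "x \<in> B"
    then have "x \<in> atoms P r z" using assms by blast
    moreover from this have "x \<in> generated P r z B"
      using x generatedI[of x B x] atomD(1) le_refl by blast
    ultimately show "x \<in> atoms (generated P r z B) r z"
      using generated_subset[of B] bot_in_generated[of B] unfolding atoms_def covers_def by auto
  qed
qed

text \<open>The chain contains the top, which differs from \<open>z\<close>, so it has a least
  element \<open>m\<close> other than \<open>z\<close>. An atom of \<open>B\<close> below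
  \<open>m\<close> is comparable to the whole chain, hence in it by maximality.\<close>

lemma max_chain_has_atom:
  assumes B: "B \<subseteq> atoms P r z" "B \<noteq> {}" and c: "c \<in> max_chains (generated P r z B) r"
  obtains a where "a \<in> B" "a \<in> c"
proof -
  note sub = generated_subset[of B]
  obtain a0 where a0: "a0 \<in> B" using B by blast
  then have a0': "a0 \<in> P" "a0 \<noteq> z" using B atomD by auto
  then have u: "u \<in> generated P r z B" "u \<noteq> z"
    using a0 generatedI[of a0 B u] top_in le_top bot_le le_antisym by auto
  have "u \<in> c"
    using max_chain_maximal[OF sub c u(1)] max_chain_subset[OF sub c] sub le_top by blast
  then obtain m where m: "m \<in> c - {z}" "\<And>x. x \<in> c - {z} \<Longrightarrow> (m, x) \<in> r"
    using chain_has_least[of "c - {z}"] u(2) max_chain_subset[OF sub c] sub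
      max_chain_comparable[OF sub c] by blast
  then obtain a where a: "a \<in> B" "(a, m) \<in> r"
    using max_chain_subset[OF sub c] unfolding generated_def by auto
  have aP: "a \<in> P" using a B atomD by auto
  have "a \<in> c"
  proof (rule max_chain_maximal[OF sub c])
    show "a \<in> generated P r z B" using a aP generatedI le_refl by blast
    show "(a, y) \<in> r \<or> (y, a) \<in> r" if "y \<in> c" for y
      using that m(2)[of y] a(2) le_trans bot_le[OF aP] by blast
  qed
  with a that show ?thesis by blast
qed

lemma comparable_atom:
  assumes "a \<in> atoms P r z" "x \<in> P" "(x, a) \<in> r \<or> (a, x) \<in> r"
  shows "x = z \<or> (a, x) \<in> r"
  using assms atomD le_refl by blast

text \<open>Whatever is comparable to an atom of \<open>B\<close> is \<open>z\<close> or lies above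
  that atom, hence belongs to the smaller subposet. So a chain through such an atom has the same
  possible extensions in both subposets. For empty \<open>B\<close> the left side is
  \<open>{{z}}\<close> and the right side is empty.\<close>

lemma max_chains_generated_subset:
  assumes "B \<subseteq> C" "C \<subseteq> atoms P r z" "B \<noteq> {}"
  shows "max_chains (generated P r z B) r =
    {c \<in> max_chains (generated P r z C) r. c \<inter> B \<noteq> {}}" (is "?L = ?R")
proof -
  note subB = generated_subset[of B] and subC = generated_subset[of C]
  have key: "x \<in> generated P r z B"
    if "a \<in> B" "x \<in> P" "(x, a) \<in> r \<or> (a, x) \<in> r" for a x
    using comparable_atom[of a x] that assms generatedI[of a B x] bot_in_generated by auto
  show ?thesis
  proof (intro equalityI subsetI)
    fix c assume c: "c \<in> ?L"
    obtain a where a: "a \<in> B" "a \<in> c"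
      using max_chain_has_atom[OF _ _ c] assms by blast
    have "c \<in> max_chains (generated P r z C) r"
      unfolding max_chains_iff[OF subC]
      using c[unfolded max_chains_iff[OF subB]] generated_mono[OF assms(1)] key[OF a(1)] a(2) subC
      by blast
    with a show "c \<in> ?R" by blast
  next
    fix c assume c: "c \<in> ?R"
    then obtain a where a: "a \<in> B" "a \<in> c" by blast
    have cC: "c \<in> max_chains (generated P r z C) r" using c by blast
    then have "c \<subseteq> generated P r z B"
      using key[OF a(1)] a(2) max_chain_subset[OF subC cC] max_chain_comparable[OF subC cC] subC
      by blast
    then show "c \<in> ?L"
      unfolding max_chains_iff[OF subB]
      using cC[unfolded max_chains_iff[OF subC]] generated_mono[OF assms(1)]
      by blast
  qed
qed

section \<open>Exchanging the atom of a maximal chain\<close>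

lemma max_chain_atom_unique:
  assumes "B \<subseteq> atoms P r z" and c: "c \<in> max_chains (generated P r z B) r"
    and "a \<in> B" "b \<in> B" "a \<in> c" "b \<in> c"
  shows "a = b"
  using max_chain_comparable[OF generated_subset c, of a b] assms atomD by blast

lemma above_atom_in_chain:
  assumes B: "B \<subseteq> atoms P r z" and c: "c \<in> max_chains (generated P r z B) r"
    and a: "a \<in> B" "a \<in> c" and x: "x \<in> c" "x \<noteq> z"
  shows "(a, x) \<in> r"
  using comparable_atom[of a x] max_chain_comparable[OF generated_subset c] assms
    max_chain_subset[OF generated_subset c] generated_subset[of B] by blast

text \<open>The new set is a chain because \<open>b\<close> lies below \<open>p\<close>, and so
  below all of \<open>c - {z, a}\<close>. A missing element comparable to all of it would be
  comparable to all of \<open>c\<close> as well, hence equal to \<open>a\<close>; but it would also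
  lie above \<open>b\<close>, forcing \<open>b = a\<close>.\<close>

lemma max_chain_exchange_atom:
  assumes B: "B \<subseteq> atoms P r z" and c: "c \<in> max_chains (generated P r z B) r"
    and a: "a \<in> B" "a \<in> c" and p: "p \<in> c" "p \<noteq> a"
    and least: "\<And>x. x \<in> c - {z, a} \<Longrightarrow> (p, x) \<in> r"
    and b: "b \<in> B" "covers P r p b"
  shows "insert b (c - {a}) \<in> max_chains (generated P r z B) r"
proof -
  note sub = generated_subset[of B]
  have bP: "b \<in> P" and bz: "b \<noteq> z" using b B atomD by auto
  have bp: "(b, p) \<in> r" using b(2) unfolding covers_def by auto
  have pz: "p \<noteq> z" using bp bz bP le_antisym bot_le by auto
  have above: "(b, x) \<in> r" if "x \<in> c - {z, a}" for x
    using least[OF that] bp le_trans by blast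
  have ap: "(a, p) \<in> r" using above_atom_in_chain[OF B c a p(1) pz] .
  show ?thesis
    unfolding max_chains_iff[OF sub]
  proof (intro conjI ballI impI)
    show "insert b (c - {a}) \<subseteq> generated P r z B"
      using max_chain_subset[OF sub c] b(1) bP generatedI le_refl by blast
    show "(x, y) \<in> r \<or> (y, x) \<in> r" if "x \<in> insert b (c - {a})" "y \<in> insert b (c - {a})" for x y
      using that above max_chain_comparable[OF sub c] bot_le[OF bP] le_refl[OF bP] by blast
  next
    fix x assume x: "x \<in> generated P r z B"
      and cmp: "\<forall>y\<in>insert b (c - {a}). (x, y) \<in> r \<or> (y, x) \<in> r"
    have xP: "x \<in> P" using x sub by blast
    show "x \<in> insert b (c - {a})"
    proof (rule ccontr)
      assume nin: "x \<notin> insert b (c - {a})"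
      have "z \<in> c"
        using max_chain_maximal[OF sub c bot_in_generated] bot_le max_chain_subset[OF sub c] sub
        by blast
      then have xz: "x \<noteq> z" using nin a B atomD(2) by blast
      have bx: "(b, x) \<in> r" using comparable_atom[of b x] b B xP cmp xz by blast
      \<comment> \<open>Otherwise \<open>x\<close> would lie strictly between \<open>b\<close> and
        \<open>p\<close>.\<close>
      have "(p, x) \<in> r"
        using b(2) cmp p nin bx xP unfolding covers_def by blast
      then have "\<And>y. y \<in> c \<Longrightarrow> (x, y) \<in> r \<or> (y, x) \<in> r"
        using cmp ap le_trans by blast
      then have "x \<in> c" using max_chain_maximal[OF sub c x] by blast
      then have "x = a" using nin by blast
      then have "b = a" using bx bz a B atomD(3)[of a b] bP by blast
      with nin \<open>x = a\<close> show False by blast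
    qed
  qed
qed

text \<open>Take for \<open>p\<close> the least element of \<open>c\<close> apart from
  \<open>z\<close> and \<open>a\<close>. Each element of \<open>d\<close> is \<open>z\<close>,
  \<open>b\<close> or above \<open>p\<close>, so anything strictly between \<open>b\<close> and
  \<open>p\<close> would belong to \<open>d\<close> by maximality, and then to
  \<open>c - {z, a}\<close>, although it is below \<open>p\<close>.\<close>

lemma exchanged_atom_covered:
  assumes B: "B \<subseteq> atoms P r z"
    and c: "c \<in> max_chains (generated P r z B) r" and d: "d \<in> max_chains (generated P r z B) r"
    and a: "a \<in> B" "a \<in> c" and b: "b \<in> B" "b \<in> d" "b \<noteq> a"
    and d_eq: "d = insert b (c - {a})"
  obtains p where "p \<in> c" "p \<noteq> a" "p \<noteq> z" "\<And>x. x \<in> c - {z, a} \<Longrightarrow> (p, x) \<in> r" "covers P r p b"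
proof -
  note sub = generated_subset[of B]
  have aP: "a \<in> P" "a \<noteq> z" and bP: "b \<in> P" "b \<noteq> z" using a b B atomD by auto
  have u: "u \<in> generated P r z B" using a(1) aP generatedI top_in le_top by blast
  have uc: "u \<in> c"
    using max_chain_maximal[OF sub c u] max_chain_subset[OF sub c] sub le_top by blast
  have "u \<noteq> z" using le_antisym bot_le le_top aP by blast
  \<comment> \<open>The second atom \<open>b\<close> lies below \<open>u\<close> but not below
    \<open>a\<close>; this keeps \<open>c - {z, a}\<close> nonempty.\<close>
  moreover have "u \<noteq> a"
    using atomD(3)[of a b] a b B bP le_top by blast
  ultimately obtain p where p: "p \<in> c - {z, a}" "\<And>x. x \<in> c - {z, a} \<Longrightarrow> (p, x) \<in> r"
    using chain_has_least[of "c - {z, a}"] uc max_chain_subset[OF sub c] sub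
      max_chain_comparable[OF sub c] by blast
  have pd: "p \<in> d" using p d_eq by blast
  have pP: "p \<in> P" using p max_chain_subset[OF sub c] sub by blast
  have bp: "(b, p) \<in> r" using above_atom_in_chain[OF B d b(1,2) pd] p by blast
  have "b \<notin> c" using max_chain_atom_unique[OF B c b(1) a(1)] a b by blast
  then have "b \<noteq> p" using p by blast
  moreover have False if w: "w \<in> P" "(b, w) \<in> r - Id" "(w, p) \<in> r - Id" for w
  proof -
    have "w \<in> d"
    proof (rule max_chain_maximal[OF sub d])
      show "w \<in> generated P r z B" using w b generatedI by blast
      show "(w, y) \<in> r \<or> (y, w) \<in> r" if "y \<in> d" for y
        using that w p(2)[of y] d_eq bot_le le_trans by blast
    qed
    then have "w \<in> c - {z, a}" using w d_eq bP bot_le le_antisym by blast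
    then show False using p(2) w le_antisym by blast
  qed
  ultimately have "covers P r p b" using bp pP bP unfolding covers_def by blast
  with p that show ?thesis by blast
qed

lemma sym_diff_exchange:
  assumes "card (sym_diff c d) = 2" "a \<in> c - d" "b \<in> d - c"
  shows "d = insert b (c - {a})"
proof -
  \<comment> \<open>An infinite set would have cardinality 0.\<close>
  have fin: "finite (sym_diff c d)" using assms(1) by (intro card_ge_0_finite) simp
  have "a \<noteq> b" using assms(2,3) by blast
  then have "card {a, b} = card (sym_diff c d)" unfolding assms(1) by simp
  moreover have "{a, b} \<subseteq> sym_diff c d" using assms(2,3) by blast
  ultimately have eq: "{a, b} = sym_diff c d" by (intro card_subset_eq[OF fin])
  show ?thesis
  proof (intro set_eqI)
    fix x
    have "x \<in> sym_diff c d \<longleftrightarrow> x = a \<or> x = b" unfolding eq[symmetric] by simp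
    then show "x \<in> d \<longleftrightarrow> x \<in> insert b (c - {a})" using assms(2,3) by auto
  qed
qed

section \<open>Restricting the shelling\<close>

lemma atom_shellable_empty: "atom_shellable P r z {} s"
proof -
  have gen: "generated P r z {} = {z}" unfolding generated_def by simp
  have mc: "max_chains {z} r = {{z}}"
  proof -
    have "c \<in> max_chains {z} r \<longleftrightarrow> c = {z}" for c
      using le_refl[OF bot_in] max_chains_iff[of "{z}" c] bot_in by blast
    then show ?thesis by blast
  qed
  \<comment> \<open>With a single maximal chain no two chains are strictly ordered, and
    \<open>{z}\<close> has no atoms, so everything but the linear order is vacuous.\<close>
  have "shelling_order {z} r {({z}, {z})}"
    unfolding shelling_order_def mc linear_order_on_def partial_order_on_def preorder_on_def
      refl_on_def trans_def antisym_def total_on_def by auto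
  then show ?thesis
    unfolding atom_shellable_def Let_def gen mc atoms_def covers_def by blast
qed

lemma atom_shellable_subset:
  assumes A: "A \<subseteq> atoms P r z" and A': "A' \<subseteq> A" "A' \<noteq> {}"
    and shell: "atom_shellable P r z A s"
    and exch: "\<And>b p. b \<in> A - A' \<Longrightarrow> p \<in> generated P r z A' \<Longrightarrow> covers P r p b \<Longrightarrow>
               \<exists>b'\<in>A'. (b', b) \<in> s - Id \<and> covers P r p b'"
  shows "atom_shellable P r z A' (Restr s A')"
proof -
  let ?M = "max_chains (generated P r z A) r" and ?M' = "max_chains (generated P r z A') r"
  have A'at: "A' \<subseteq> atoms P r z" using A A' by blast
  have M': "?M' = {c \<in> ?M. c \<inter> A' \<noteq> {}}"
    using max_chains_generated_subset[OF A'(1) A A'(2)] .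
  obtain t where t: "shelling_order (generated P r z A) r t"
    and compat: "\<And>c c' a a'. c \<in> ?M \<Longrightarrow> c' \<in> ?M \<Longrightarrow> a \<in> c \<inter> A \<Longrightarrow> a' \<in> c' \<inter> A \<Longrightarrow>
        (a', a) \<in> s - Id \<Longrightarrow> (c', c) \<in> t - Id"
    using shell unfolding atom_shellable_def Let_def atoms_generated[OF A] by metis
  have lin: "linear_order_on ?M t"
    and shelling: "\<And>c c'. c \<in> ?M \<Longrightarrow> c' \<in> ?M \<Longrightarrow> (c', c) \<in> t - Id \<Longrightarrow>
        \<exists>d\<in>?M. (d, c) \<in> t - Id \<and> c \<inter> c' \<subseteq> c \<inter> d \<and> card (sym_diff c d) = 2"
    using t unfolding shelling_order_def by blast+
  have t_strict_trans: "(x, y) \<in> t - Id \<Longrightarrow> (y, w) \<in> t - Id \<Longrightarrow> (x, w) \<in> t - Id" for x y w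
    using lin unfolding order_on_defs by (meson trans_diff_Id transD)
  have step: "\<exists>d\<in>?M'. (d, c) \<in> t - Id \<and> c \<inter> c' \<subseteq> c \<inter> d \<and> card (sym_diff c d) = 2"
    if c: "c \<in> ?M'" and c': "c' \<in> ?M'" and less: "(c', c) \<in> t - Id" for c c'
  proof -
    have cM: "c \<in> ?M" "c' \<in> ?M" using c c' M' by auto
    obtain d where d: "d \<in> ?M" "(d, c) \<in> t - Id" "c \<inter> c' \<subseteq> c \<inter> d" "card (sym_diff c d) = 2"
      using shelling[OF cM less] by blast
    show ?thesis
    proof (cases "d \<in> ?M'")
      case True
      with d show ?thesis by blast
    next
      case False
      obtain a where a: "a \<in> A'" "a \<in> c" using c M' by blast
      obtain b where b: "b \<in> A" "b \<in> d" using max_chain_has_atom[OF A _ d(1)] A' by blast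
      \<comment> \<open>By \<open>M'\<close>, a chain of \<open>?M\<close> outside
        \<open>?M'\<close> misses \<open>A'\<close> altogether.\<close>
      have ad: "a \<notin> d" and bA': "b \<in> A - A'" using False M' a b d(1) by auto
      then have "b \<noteq> a" using a by blast
      then have "b \<notin> c" using max_chain_atom_unique[OF A cM(1), of a b] a b A' by blast
      have d_eq: "d = insert b (c - {a})"
        using sym_diff_exchange[OF d(4)] a ad b \<open>b \<notin> c\<close> by blast
      obtain p where p: "p \<in> c" "p \<noteq> a" "p \<noteq> z" "\<And>x. x \<in> c - {z, a} \<Longrightarrow> (p, x) \<in> r"
          "covers P r p b"
        using exchanged_atom_covered[OF A cM(1) d(1) _ a(2) b \<open>b \<noteq> a\<close> d_eq] a A' by blast
      \<comment> \<open>As \<open>c\<close> is a chain of the smaller subposet, its element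
        \<open>p\<close> satisfies the premise of \<open>exch\<close>.\<close>
      have "p \<in> generated P r z A'"
        using p(1) max_chain_subset[OF generated_subset c] by blast
      then obtain b' where b': "b' \<in> A'" "(b', b) \<in> s - Id" "covers P r p b'"
        using exch[OF bA' _ p(5)] by blast
      define d' where "d' = insert b' (c - {a})"
      have d': "d' \<in> ?M'"
        unfolding d'_def using max_chain_exchange_atom[OF A'at c a p(1,2,4) b'(1,3)] .
      \<comment> \<open>The atoms of \<open>d'\<close> and \<open>d\<close> are \<open>b'\<close>
        and \<open>b\<close>, and \<open>b'\<close> is strictly smaller in \<open>s\<close>.\<close>
      then have "(d', d) \<in> t - Id"
        using compat[OF d(1), of d' b b'] b b' M' A' unfolding d'_def by blast
      then have d'c: "(d', c) \<in> t - Id" using d(2) t_strict_trans by blast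
      \<comment> \<open>Had the exchange returned \<open>a\<close>, \<open>d'\<close> would be
        \<open>c\<close>, which does not strictly precede itself.\<close>
      then have "b' \<noteq> a" using a unfolding d'_def by (auto simp: insert_absorb)
      then have "b' \<notin> c" using max_chain_atom_unique[OF A'at c a(1) b'(1)] a by blast
      then have "sym_diff c d' = {a, b'}" using a unfolding d'_def by blast
      then have "card (sym_diff c d') = 2" using \<open>b' \<noteq> a\<close> by simp
      \<comment> \<open>The intersection with \<open>c'\<close> lies in \<open>d\<close>, so it
        omits \<open>a\<close>, and \<open>a\<close> is all that \<open>d'\<close> loses from
        \<open>c\<close>.\<close>
      moreover have "c \<inter> c' \<subseteq> c \<inter> d'" using d(3) ad unfolding d_eq d'_def by blast
      ultimately show ?thesis using d' d'c by blast
    qed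
  qed
  have "shelling_order (generated P r z A') r (Restr t ?M')"
    unfolding shelling_order_def
  proof (intro conjI ballI impI)
    show "linear_order_on ?M' (Restr t ?M')"
      using linear_order_on_Restr_subset[OF lin] M' by blast
    show "\<exists>d\<in>?M'. (d, c) \<in> Restr t ?M' - Id \<and> c \<inter> c' \<subseteq> c \<inter> d \<and> card (sym_diff c d) = 2"
      if "c \<in> ?M'" "c' \<in> ?M'" "(c', c) \<in> Restr t ?M' - Id" for c c'
      using step[of c c'] that by blast
  qed
  moreover have "(c', c) \<in> Restr t ?M' - Id"
    if "c \<in> ?M'" "c' \<in> ?M'" "a \<in> c \<inter> A'" "a' \<in> c' \<inter> A'" "(a', a) \<in> Restr s A' - Id" for c c' a a'
    using compat[of c c' a a'] that M' A' by blast
  ultimately show ?thesis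
    unfolding atom_shellable_def Let_def atoms_generated[OF A'at] by blast
qed

end

theorem theorem4:
  fixes P :: "'a set" and r :: "'a rel" and z u :: 'a
    and A A' :: "'a set" and s :: "'a rel"
  assumes "finite P" and "partial_order_on P r" and "graded P r"
    and "z \<in> P" and "\<forall>x\<in>P. (z, x) \<in> r"
    and "u \<in> P" and "\<forall>x\<in>P. (x, u) \<in> r"
    and "A \<subseteq> atoms P r z" and "partial_order_on A s"
    and "A' \<subseteq> A" and "linear_order_on A' (Restr s A')"
    and i: "atom_shellable P r z A s"
    and ii: "\<forall>b \<in> A - A'. \<forall>p \<in> generated P r z A'. covers P r p b \<longrightarrow>
               (\<exists>b'\<in>A'. (b', b) \<in> s - Id \<and> covers P r p b')"
  shows "atom_shellable P r z A' (Restr s A')"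
proof -
  interpret finite_bounded_poset P r z u
    using assms(1,2,4-7) by unfold_locales auto
  \<comment> \<open>Empty \<open>A'\<close> stands apart: the only maximal chain is then
    \<open>{z}\<close>, which contains no atom and so is not found among the chains through
    \<open>A'\<close>.\<close>
  show ?thesis
    using atom_shellable_empty atom_shellable_subset[OF assms(8,10) _ i] ii by (cases "A' = {}") auto
qed

end
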